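(* Let $X$ be a hyperelliptic curve of genus $g$ over a field $F$ with $\mathrm{char}(F)\ne2$, with affine model $y^2=f(x)$, $\deg f=2g+1$. Assume that $1\le\ell\le g$ and $\ell\equiv1\pmod4$. Near $\infty_X$, with $z=x^{-1}$, $w=yx^{-(g+1)}$, and $\mathcal{O}_X(2\ell\infty_X)$ trivialized by the generator $x^\ell$, the basis $(1,x,\dots,x^\ell)$ of the complete linear series defined by $\mathcal{O}_X(2\ell\infty_X)$ becomes $\lambda=(z^\ell,z^{\ell-1},\dots,z,1)$. In terms of the local Nisnevich coordinate $w$ at $\infty_X$, the Hasse Wronskian is $$w(\lambda)=-\left(\frac{Dz}{dw}\right)^{\binom{\ell+1}2}.$$
   Context: $X$ is smooth and projective and $\infty_X$ is the point over $x=\infty$. Near $\infty_X$ (which is $(z,w)=(0,0)$), $X$ is given by $w^2=h(z)$ with $h(z)=z^{2g+2}f(z^{-1})$, and the function $w$ is an étale coordinate. Hasse derivatives with respect to $w$: $\frac{D^k}{dw}$ ($k\ge0$), acting on functions near $\infty_X$, are the unique $F$-linear maps with $D^0=\mathrm{id}$, $\frac{D^k(\phi\psi)}{dw}=\sum_{i=0}^k\frac{D^i\phi}{dw}\frac{D^{k-i}\psi}{dw}$ and $\frac{D^kw^n}{dw}=\binom nkw^{n-k}$; $\frac{D}{dw}=\frac{D^1}{dw}$. In this trivialization the Hasse Wronskian of $\lambda=(\lambda_0,\dots,\lambda_\ell)$, $\lambda_j=z^{\ell-j}$, is $w(\lambda)=\det\left(\frac{D^i\lambda_j}{dw}\right)_{0\le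 i,j\le\ell}$. *)

theory Defs
  imports
    "HOL-Computational_Algebra.Polynomial"
    "Jordan_Normal_Form.Determinant"
begin

text \<open>
  A polynomial \<open>P\<close> in two variables over \<open>F\<close> is an \<open>F poly poly\<close>: the coefficients are polynomials
  in the first variable, and the outer polynomial is in the second variable.
  Here \<open>emb\<close> is the embedding of \<open>F\<close> into a field in which \<open>P\<close> is evaluated.
\<close>

definition eval2 :: "('a::field \<Rightarrow> 'k::field) \<Rightarrow> 'a poly poly \<Rightarrow> 'k \<Rightarrow> 'k \<Rightarrow> 'k" where
  "eval2 emb P a b = poly (map_poly (\<lambda>p. poly (map_poly emb p) a) P) b"

text \<open>
  Jacobian criterion for \<open>{G = 0}\<close> in the affine plane: \<open>G\<close> and its two partial derivatives generate
  the unit ideal, that is, there is no singular point even over an algebraic closure of \<open>F\<close>.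
\<close>

definition smooth_plane_curve :: "'a::field poly poly \<Rightarrow> bool" where
  "smooth_plane_curve G \<longleftrightarrow>
     (\<exists>A B C. A * G + B * map_poly pderiv G + C * pderiv G = 1)"

text \<open>The polynomial \<open>z^(2 g + 2) f(1/z)\<close>; note that \<open>reflect_poly f\<close> is \<open>z^(degree f) f(1/z)\<close>.\<close>

definition poly_at_infinity :: "nat \<Rightarrow> 'a::field poly \<Rightarrow> 'a poly" where
  "poly_at_infinity g f = monom 1 (2 * g + 2 - degree f) * reflect_poly f"

text \<open>
  The smooth projective curve \<open>X\<close> over \<open>F\<close> is glued from the affine plane curves \<open>y^2 = f(x)\<close> and
  \<open>w^2 = h(z)\<close> along \<open>z = 1/x\<close>, \<open>w = y/x^(g+1)\<close>. Its rational functions are represented in an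
  extension field \<open>'k\<close> of \<open>F\<close> containing elements \<open>x\<close> (transcendental over \<open>F\<close>) and \<open>y\<close>
  with \<open>y^2 = f(x)\<close>. As \<open>f\<close> has odd degree, it is not a square in \<open>F(x)\<close>, so the subfield \<open>F(x,y)\<close>
  is the function field of \<open>X\<close>; the field \<open>'k\<close> may be larger, but everything
  below only involves elements of \<open>F(x,y)\<close>.
\<close>

locale hyperelliptic_curve = field_hom emb
  for emb :: "'a::field \<Rightarrow> 'k::field" +
  fixes f :: "'a poly" and g :: nat and x y :: 'k
  assumes char_neq_2: "CHAR('a) \<noteq> 2"
    and degree_f: "degree f = 2 * g + 1"
    and smooth_affine: "smooth_plane_curve [:- f, 0, 1:]"
    and smooth_at_infinity: "smooth_plane_curve [:- poly_at_infinity g f, 0, 1:]"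
    and transcendental_x: "\<And>p. p \<noteq> 0 \<Longrightarrow> poly (map_poly emb p) x \<noteq> 0"
    and curve_equation: "y ^ 2 = poly (map_poly emb f) x"

text \<open>The regular functions on \<open>X\<close> minus its point at infinity.\<close>

definition affine_coordinate_ring ::
    "('a::field \<Rightarrow> 'k::field) \<Rightarrow> 'k \<Rightarrow> 'k \<Rightarrow> 'k set" where
  "affine_coordinate_ring emb x y = {eval2 emb P x y | P. True}"

text \<open>
  The local ring of \<open>X\<close> at infinity, i.e. the germs of regular functions at the point \<open>(0,0)\<close> of
  \<open>w^2 = h(z)\<close>. All denominators are nonzero in \<open>'k\<close>: if \<open>Q(z,w) = 0\<close> in \<open>F(x,y)\<close>, then \<open>Q\<close> is a
  multiple of \<open>w^2 - h(z)\<close> and vanishes at \<open>(0,0)\<close>.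
\<close>

definition local_ring_at_infinity ::
    "('a::field \<Rightarrow> 'k::field) \<Rightarrow> 'k \<Rightarrow> 'k \<Rightarrow> 'k set" where
  "local_ring_at_infinity emb z w =
     {eval2 emb P z w / eval2 emb Q z w | P Q. poly (poly Q 0) 0 \<noteq> 0}"

text \<open>
  The stalk at infinity of the line bundle of the divisor \<open>n \<infinity>\<close> (functions with a pole of order at
  most \<open>n\<close> at infinity), and its global sections. The function \<open>w\<close> is a uniformizer at infinity, hence
  a local equation of the divisor \<open>\<infinity>\<close>.
\<close>

definition divisor_stalk_at_infinity ::
    "('a::field \<Rightarrow> 'k::field) \<Rightarrow> 'k \<Rightarrow> 'k \<Rightarrow> nat \<Rightarrow> 'k set" where
  "divisor_stalk_at_infinity emb z w n = {\<phi>. w ^ n * \<phi> \<in> local_ring_at_infinity emb z w}"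

definition divisor_global_sections ::
    "('a::field \<Rightarrow> 'k::field) \<Rightarrow> 'k \<Rightarrow> 'k \<Rightarrow> 'k \<Rightarrow> 'k \<Rightarrow> nat \<Rightarrow> 'k set" where
  "divisor_global_sections emb x y z w n =
     affine_coordinate_ring emb x y \<inter> divisor_stalk_at_infinity emb z w n"

text \<open>The family \<open>b 0, \<dots>, b l\<close> is an \<open>F\<close>-basis of \<open>V\<close>.\<close>

definition is_basis_family ::
    "('a::field \<Rightarrow> 'k::field) \<Rightarrow> nat \<Rightarrow> (nat \<Rightarrow> 'k) \<Rightarrow> 'k set \<Rightarrow> bool" where
  "is_basis_family emb l b V \<longleftrightarrow>
     inj_on b {..l} \<and>
     \<not> module.dependent (\<lambda>c v. emb c * v) (b ` {..l}) \<and>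
     module.span (\<lambda>c v. emb c * v) (b ` {..l}) = V"

text \<open>
  \<open>D k\<close> is the \<open>k\<close>-th Hasse derivative with respect to \<open>w\<close> on the ring \<open>R\<close> of functions; its values
  outside \<open>R\<close> are irrelevant. For \<open>n < k\<close> the binomial coefficient vanishes, so the truncated
  exponent \<open>n - k\<close> is harmless. On the local ring of \<open>X\<close> at infinity, where \<open>w\<close> is an etale
  coordinate, these conditions determine the restriction of \<open>D\<close> to \<open>R\<close> uniquely.
\<close>

definition hasse_derivatives ::
    "('a::field \<Rightarrow> 'k::field) \<Rightarrow> 'k set \<Rightarrow> 'k \<Rightarrow> (nat \<Rightarrow> 'k \<Rightarrow> 'k) \<Rightarrow> bool" where
  "hasse_derivatives emb R w D \<longleftrightarrow>
     (\<forall>k. \<forall>\<phi>\<in>R. D k \<phi> \<in> R) \<and>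
     (\<forall>k. \<forall>\<phi>\<in>R. \<forall>\<psi>\<in>R. D k (\<phi> + \<psi>) = D k \<phi> + D k \<psi>) \<and>
     (\<forall>k c. \<forall>\<phi>\<in>R. D k (emb c * \<phi>) = emb c * D k \<phi>) \<and>
     (\<forall>\<phi>\<in>R. D 0 \<phi> = \<phi>) \<and>
     (\<forall>k. \<forall>\<phi>\<in>R. \<forall>\<psi>\<in>R. D k (\<phi> * \<psi>) = (\<Sum>i\<le>k. D i \<phi> * D (k - i) \<psi>)) \<and>
     (\<forall>k n. D k (w ^ n) = of_nat (n choose k) * w ^ (n - k))"

definition hasse_wronskian :: "(nat \<Rightarrow> 'k \<Rightarrow> 'k) \<Rightarrow> nat \<Rightarrow> (nat \<Rightarrow> 'k) \<Rightarrow> 'k::field" where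
  "hasse_wronskian D l b = det (mat (l + 1) (l + 1) (\<lambda>(i, j). D i (b j)))"

end

theory Submission
  imports
    Defs
    "Jordan_Normal_Form.Char_Poly"
    "HOL-Computational_Algebra.Formal_Power_Series"
begin

text \<open>
  The powers of a function \<open>z\<close> have Wronskian \<open>(D z / dw)\<close> to the power \<open>(l + 1) choose 2\<close>, up to
  the sign of reversing \<open>l + 1\<close> columns; this sign is \<open>-1\<close> for \<open>l\<close> congruent to \<open>1\<close> modulo \<open>4\<close>.
  Everything about the linear series rests on \<open>w\<^sup>2\<close> being \<open>z\<close> times a unit at infinity. Hence \<open>w\<close> is
  not in \<open>F(z)\<close>, and a germ at infinity is \<open>(p(z) + q(z) w) / n(z)\<close> with \<open>n(0)\<close> nonzero. Comparing
  this with \<open>z^l (a(x) + b(x) y)\<close>, where \<open>y = w / z^(g + 1)\<close>, bounds \<open>degree a\<close> by \<open>l\<close> and, if \<open>b\<close> is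
  nonzero, \<open>degree b + g + 1\<close> by \<open>l\<close>, which is impossible for \<open>l\<close> at most \<open>g\<close>.
\<close>

section \<open>Antitriangular determinants\<close>

text \<open>Expand along the last row, whose only possibly nonzero entry is in column 0. The minor
  has the same shape, and the cofactor signs accumulate to the exponent n choose 2.\<close>

lemma det_upper_antitriangular:
  fixes a :: "nat \<Rightarrow> nat \<Rightarrow> 'b::comm_ring_1"
  assumes "\<And>i j. i < n \<Longrightarrow> j < n \<Longrightarrow> n \<le> i + j \<Longrightarrow> a i j = 0"
  shows "det (mat n n (\<lambda>(i, j). a i j)) = (- 1) ^ (n choose 2) * (\<Prod>i<n. a i (n - 1 - i))"
  using assms
proof (induction n arbitrary: a)
  case 0
  show ?case by (simp add: binomial_eq_0)
next
  case (Suc n)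
  let ?M = "mat (Suc n) (Suc n) (\<lambda>(i, j). a i j)"
  let ?N = "mat n n (\<lambda>(i, j). a i (Suc j))"
  have "det ?M = (\<Sum>j<Suc n. ?M $$ (n, j) * cofactor ?M n j)"
    by (rule laplace_expansion_row) auto
  also have "\<dots> = (\<Sum>j\<in>{0}. ?M $$ (n, j) * cofactor ?M n j)"
    by (rule sum.mono_neutral_right) (auto simp: Suc.prems)
  also have "\<dots> = a n 0 * cofactor ?M n 0"
    by simp
  also have "mat_delete ?M n 0 = ?N"
    by (rule eq_matI) (auto simp: mat_delete_def)
  then have "cofactor ?M n 0 = (- 1) ^ n * det ?N"
    by (simp add: cofactor_def)
  also have "det ?N = (- 1) ^ (n choose 2) * (\<Prod>i<n. a i (Suc (n - 1 - i)))"
    by (rule Suc.IH) (auto intro!: Suc.prems)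
  also have "(\<Prod>i<n. a i (Suc (n - 1 - i))) = (\<Prod>i<n. a i (n - i))"
    by (intro prod.cong) (auto simp: Suc_diff_Suc)
  finally show ?case
    by (simp add: power_add numeral_2_eq_2 mult_ac)
qed

section \<open>The Hasse Wronskian of the powers of a function\<close>

text \<open>The Leibniz rule is the Cauchy product, so Taylor expansion is multiplicative. Only
  powers of \<open>z\<close> occur because the rules for \<open>D\<close> hold on a subring of
  \<open>'k\<close>.\<close>

lemma fps_nth_power_Abs_fps:
  fixes D :: "nat \<Rightarrow> 'k::field \<Rightarrow> 'k"
  assumes one: "\<And>k. D k 1 = (if k = 0 then 1 else 0)"
    and Leibniz: "\<And>k n. D k (z * z ^ n) = (\<Sum>i\<le>k. D i z * D (k - i) (z ^ n))"
  shows "D k (z ^ n) = fps_nth (Abs_fps (\<lambda>i. D i z) ^ n) k"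
proof (induction n arbitrary: k)
  case 0
  then show ?case by (simp add: one)
next
  case (Suc n)
  then show ?case
    by (simp add: Leibniz fps_mult_nth atLeast0AtMost)
qed

text \<open>
  With the Taylor expansion \<open>z + T\<close> of \<open>z\<close>, the binomial theorem for \<open>(z + T) ^ n\<close> factors the
  Wronskian matrix into a lower triangular and an antitriangular one.
\<close>

lemma hasse_wronskian_powers:
  fixes D :: "nat \<Rightarrow> 'k::field \<Rightarrow> 'k"
  assumes one: "\<And>k. D k 1 = (if k = 0 then 1 else 0)"
    and zero: "D 0 z = z"
    and Leibniz: "\<And>k n. D k (z * z ^ n) = (\<Sum>i\<le>k. D i z * D (k - i) (z ^ n))"
  shows "hasse_wronskian D l (\<lambda>j. z ^ (l - j))
    = (- 1) ^ ((l + 1) choose 2) * D 1 z ^ ((l + 1) choose 2)"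
proof -
  define Z where "Z = Abs_fps (\<lambda>i. D i z)"
  define T where "T = Z - fps_const z"
  have T0: "fps_nth T 0 = 0" and T1: "fps_nth T 1 = D 1 z"
    by (simp_all add: T_def Z_def zero)
  \<comment> \<open>The summation range is the same for all \<open>n\<close>, so that this becomes
    an entry of a matrix product; for k > n the binomial coefficient vanishes.\<close>
  have D_power: "D i (z ^ n) = (\<Sum>k\<le>l. fps_nth (T ^ k) i * (of_nat (n choose k) * z ^ (n - k)))"
    if "n \<le> l" for i n
  proof -
    have "Z = T + fps_const z" by (simp add: T_def)
    then have "Z ^ n = (\<Sum>k\<le>n. of_nat (n choose k) * T ^ k * fps_const z ^ (n - k))"
      by (simp add: binomial_ring)
    also have "\<dots> = (\<Sum>k\<le>n. T ^ k * fps_const (of_nat (n choose k) * z ^ (n - k)))"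
      by (simp add: fps_of_nat [symmetric] fps_const_power mult_ac flip: fps_const_mult)
    finally have "D i (z ^ n) = (\<Sum>k\<le>n. fps_nth (T ^ k) i * (of_nat (n choose k) * z ^ (n - k)))"
      using fps_nth_power_Abs_fps [of D, OF one Leibniz]
      by (simp add: Z_def fps_sum_nth)
    also have "\<dots> = (\<Sum>k\<le>l. fps_nth (T ^ k) i * (of_nat (n choose k) * z ^ (n - k)))"
      using that by (intro sum.mono_neutral_left) (auto simp: binomial_eq_0)
    finally show ?thesis .
  qed
  \<comment> \<open>\<open>A\<close> is lower triangular: T^k starts in degree k, with coefficient
    (D 1 z)^k. \<open>B\<close> vanishes for k + j > l because of its binomial coefficients.\<close>
  define A where "A = mat (l + 1) (l + 1) (\<lambda>(i, k). fps_nth (T ^ k) i)"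
  define B where "B = mat (l + 1) (l + 1) (\<lambda>(k, j). of_nat ((l - j) choose k) * z ^ (l - j - k))"
  have carrier: "A \<in> carrier_mat (l + 1) (l + 1)" "B \<in> carrier_mat (l + 1) (l + 1)"
    by (simp_all add: A_def B_def)
  have "mat (l + 1) (l + 1) (\<lambda>(i, j). D i (z ^ (l - j))) = A * B"
    by (rule eq_matI)
      (auto simp: A_def B_def D_power scalar_prod_def atLeast0LessThan simp flip: lessThan_Suc_atMost
        intro!: sum.cong)
  then have "hasse_wronskian D l (\<lambda>j. z ^ (l - j)) = det A * det B"
    by (simp add: hasse_wronskian_def det_mult [OF carrier])
  also have "det A = D 1 z ^ ((l + 1) choose 2)"
  proof -
    have "det A = prod_list (diag_mat A)"
      by (rule det_lower_triangular [OF _ carrier(1)])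
        (auto simp: A_def startsby_zero_power_prefix [OF T0])
    also have "\<dots> = (\<Prod>k<l + 1. D 1 z ^ k)"
      using T1 by (simp add: A_def prod_list_diag_prod atLeast0LessThan
          startsby_zero_power_nth_same [OF T0])
    also have "\<dots> = D 1 z ^ (\<Sum>k\<le>l. k)"
      by (simp add: power_sum lessThan_Suc_atMost)
    also have "(\<Sum>k\<le>l. k) = (l + 1) choose 2"
      by (simp add: gauss_sum_nat choose_two mult.commute atMost_atLeast0)
    finally show ?thesis .
  qed
  also have "det B = (- 1) ^ ((l + 1) choose 2)"
  proof -
    have "det B = (- 1) ^ ((l + 1) choose 2) *
        (\<Prod>i<l + 1. of_nat ((l - (l + 1 - 1 - i)) choose i) * z ^ (l - (l + 1 - 1 - i) - i))"
      unfolding B_def by (rule det_upper_antitriangular) (simp add: binomial_eq_0)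
    \<comment> \<open>On the antidiagonal j = l - i, so each entry is (i choose i) * z^0.\<close>
    also have "(\<Prod>i<l + 1. of_nat ((l - (l + 1 - 1 - i)) choose i) * z ^ (l - (l + 1 - 1 - i) - i))
        = (\<Prod>i<l + 1. 1 :: 'k)"
      by (intro prod.cong) auto
    finally show ?thesis by simp
  qed
  finally show ?thesis by (simp add: mult.commute)
qed

lemma odd_choose_two_of_mod_4:
  assumes "l mod 4 = (1 :: nat)"
  shows "odd ((l + 1) choose 2)"
proof -
  obtain m where "l = 4 * m + 1"
    using assms by (metis mult.commute mult_div_mod_eq)
  then have "(l + 1) choose 2 = (4 * m + 1) * (2 * m + 1)"
    by (simp add: choose_two algebra_simps)
  then show ?thesis by simp
qed

section \<open>Evaluation of polynomials at a point of the curve\<close>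

context field_hom
begin

lemmas [simp] = poly_monom

abbreviation ev :: "'a poly \<Rightarrow> 'b \<Rightarrow> 'b" where
  "ev p a \<equiv> poly (map_poly hom p) a"

lemma comm_ring_hom_ev: "comm_ring_hom (\<lambda>p. ev p a)"
proof -
  interpret m: map_poly_comm_ring_hom hom ..
  show ?thesis by unfold_locales (auto simp: hom_distribs)
qed

lemma ev_simps [simp]:
  "ev 0 a = 0" "ev 1 a = 1" "ev (p + q) a = ev p a + ev q a" "ev (p - q) a = ev p a - ev q a"
  "ev (- p) a = - ev p a" "ev (p * q) a = ev p a * ev q a" "ev (p ^ n) a = ev p a ^ n"
  "ev (pCons c p) a = hom c + a * ev p a"
proof -
  interpret e: comm_ring_hom "\<lambda>p. ev p a" by (rule comm_ring_hom_ev)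
  show "ev 0 a = 0" "ev 1 a = 1" "ev (p + q) a = ev p a + ev q a" "ev (p - q) a = ev p a - ev q a"
    "ev (- p) a = - ev p a" "ev (p * q) a = ev p a * ev q a" "ev (p ^ n) a = ev p a ^ n"
    by (simp_all add: e.hom_add e.hom_minus e.hom_uminus e.hom_mult e.hom_power)
  show "ev (pCons c p) a = hom c + a * ev p a"
    by (simp add: map_poly_pCons_hom)
qed

lemma ev_reflect_poly:
  assumes "a \<noteq> 0"
  shows "ev (reflect_poly p) a = a ^ degree p * ev p (inverse a)"
proof -
  have "map_poly hom (reflect_poly p) = reflect_poly (map_poly hom p)"
    by (rule poly_eqI) (simp add: coeff_reflect_poly)
  then show ?thesis
    using poly_reflect_poly_nz [OF assms, of "map_poly hom p"] by simp
qed

lemma ev_eq_sum: "ev p a = (\<Sum>i\<le>degree p. hom (coeff p i) * a ^ i)"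
  by (simp add: poly_altdef)

lemma eval2_simps [simp]:
  "eval2 hom (P * Q) a b = eval2 hom P a b * eval2 hom Q a b"
  "eval2 hom 0 a b = 0" "eval2 hom (pCons p P) a b = ev p a + b * eval2 hom P a b"
proof -
  interpret e: comm_ring_hom "\<lambda>p. ev p a" by (rule comm_ring_hom_ev)
  interpret m: map_poly_comm_ring_hom "\<lambda>p. ev p a" ..
  show "eval2 hom (P * Q) a b = eval2 hom P a b * eval2 hom Q a b"
    "eval2 hom 0 a b = 0" "eval2 hom (pCons p P) a b = ev p a + b * eval2 hom P a b"
    by (simp_all add: eval2_def m.hom_mult e.map_poly_pCons_hom)
qed

text \<open>Horner's scheme in the outer variable, replacing b^2 by h(a). If h(0) = 0, this
  preserves the value at the origin, which keeps denominators of germs nonzero there.\<close>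

lemma eval2_reduce:
  assumes "b ^ 2 = ev h a"
  shows "\<exists>p q. eval2 hom P a b = ev p a + ev q a * b
    \<and> (poly h 0 = 0 \<longrightarrow> poly p 0 = poly (poly P 0) 0)"
proof (induction P)
  case 0
  show ?case by (intro exI [of _ 0]) simp
next
  case (pCons c P)
  then obtain p q where pq: "eval2 hom P a b = ev p a + ev q a * b" by blast
  have "eval2 hom (pCons c P) a b = ev (c + q * h) a + ev p a * b"
    by (simp add: pq assms [symmetric] power2_eq_square algebra_simps)
  moreover have "poly h 0 = 0 \<longrightarrow> poly (c + q * h) 0 = poly (poly (pCons c P) 0) 0"
    by simp
  ultimately show ?case by blast
qed

lemma local_ring_mult:
  assumes "\<phi> \<in> local_ring_at_infinity hom a b" "\<psi> \<in> local_ring_at_infinity hom a b"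
  shows "\<phi> * \<psi> \<in> local_ring_at_infinity hom a b"
proof -
  obtain P Q P' Q' where "\<phi> = eval2 hom P a b / eval2 hom Q a b" "poly (poly Q 0) 0 \<noteq> 0"
    "\<psi> = eval2 hom P' a b / eval2 hom Q' a b" "poly (poly Q' 0) 0 \<noteq> 0"
    using assms by (auto simp: local_ring_at_infinity_def)
  then have "\<phi> * \<psi> = eval2 hom (P * P') a b / eval2 hom (Q * Q') a b
      \<and> poly (poly (Q * Q') 0) 0 \<noteq> 0"
    by simp
  then show ?thesis by (auto simp only: local_ring_at_infinity_def)
qed

lemma ev_divide_in_local_ring:
  assumes "poly q 0 \<noteq> 0"
  shows "ev p a / ev q a \<in> local_ring_at_infinity hom a b"
  using assms unfolding local_ring_at_infinity_def
  by (intro CollectI exI [of _ "[:p:]"] exI [of _ "[:q:]"]) simp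

lemma ev_in_local_ring: "ev p a \<in> local_ring_at_infinity hom a b"
  using ev_divide_in_local_ring [of 1 p a b] by simp

lemma power_in_local_ring: "a ^ n \<in> local_ring_at_infinity hom a b"
  using ev_in_local_ring [of "monom 1 n" a b] by simp

end

section \<open>The local ring at infinity and the sections of the divisor\<close>

text \<open>The factor \<open>n\<close> contributes nothing to the order of vanishing at 0.\<close>

lemma monom_dvd_mult_cancel:
  fixes p n :: "'a::field poly"
  assumes "monom 1 m dvd p * n" "poly n 0 \<noteq> 0"
  shows "monom 1 m dvd p"
proof (cases "p = 0")
  case False
  with assms have "m \<le> order 0 (p * n)"
    by (subst (asm) monom_1_dvd_iff) auto
  also have "\<dots> = order 0 p"
    using False assms(2) by (subst order_mult) (auto simp: order_0I)
  finally show ?thesis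
    using False by (simp add: monom_1_dvd_iff)
qed simp

text \<open>The constant term of \<open>reflect_poly p\<close> is the leading coefficient of
  \<open>p\<close>, hence nonzero. This later turns divisibility by powers of z into degree
  bounds.\<close>

lemma monom_dvd_monom_mult_reflect_poly:
  fixes p :: "'a::field poly"
  assumes "monom 1 m dvd monom 1 n * reflect_poly p" "p \<noteq> 0"
  shows "m \<le> n"
proof -
  have "monom 1 m dvd (monom 1 n :: 'a poly)"
    by (rule monom_dvd_mult_cancel [OF assms(1)]) (simp add: assms(2))
  then show ?thesis
    using dvd_imp_degree_le [of "monom 1 m" "monom (1::'a) n"]
    by (simp add: degree_monom_eq)
qed

context hyperelliptic_curve
begin

section \<open>The coordinates z and w at infinity\<close>

definition z where "z = inverse x"
definition w where "w = y / x ^ (g + 1)"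

lemma x_nonzero: "x \<noteq> 0"
  using transcendental_x [of "[:0, 1:]"] by simp

lemma z_nonzero: "z \<noteq> 0"
  by (simp add: z_def x_nonzero)

lemma f_nonzero: "f \<noteq> 0"
  using degree_f by auto

lemma ev_z_nonzero:
  assumes "p \<noteq> 0"
  shows "ev p z \<noteq> 0"
proof -
  have "ev (reflect_poly p) x = x ^ degree p * ev p z"
    by (simp add: ev_reflect_poly x_nonzero z_def)
  then show ?thesis
    using transcendental_x [of "reflect_poly p"] assms by auto
qed

lemma ev_z_inject: "ev p z = ev q z \<longleftrightarrow> p = q"
  using ev_z_nonzero [of "p - q"] by auto

lemma ev_x_eq: "ev p x = x ^ degree p * ev (reflect_poly p) z"
  by (simp add: ev_reflect_poly z_nonzero) (simp add: z_def x_nonzero power_inverse)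

text \<open>This equals \<open>poly_at_infinity g f\<close>: as \<open>f\<close> has degree 2g + 1,
  the monomial factor there is z itself.\<close>

abbreviation h where "h \<equiv> pCons 0 (reflect_poly f)"

lemma w_squared: "w ^ 2 = ev h z"
proof -
  have "w ^ 2 = y ^ 2 / x ^ (2 * g + 2)"
    by (simp add: w_def power_divide power2_eq_square power_add mult_2_right mult_ac)
  also have "\<dots> = x ^ (2 * g + 1) * ev (reflect_poly f) z / x ^ (2 * g + 2)"
    by (simp add: curve_equation ev_x_eq degree_f)
  also have "\<dots> = ev h z"
    using x_nonzero by (simp add: z_def field_simps power2_eq_square power_add)
  finally show ?thesis .
qed

text \<open>A relation gives p^2 = q^2 h. Since h has a simple zero at 0, the orders of the two
  sides at 0 have different parity unless both vanish.\<close>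

lemma w_independent:
  assumes "ev p z + ev q z * w = 0"
  shows "p = 0 \<and> q = 0"
proof -
  have "ev p z = - (ev q z * w)"
    using assms by (simp add: eq_neg_iff_add_eq_0)
  then have "ev (p ^ 2) z = ev (q ^ 2 * h) z"
    by (simp add: power_mult_distrib w_squared)
  then have eq: "p ^ 2 = q ^ 2 * h"
    by (simp only: ev_z_inject)
  have q: "q = 0"
  proof (rule ccontr)
    assume q: "q \<noteq> 0"
    then have p: "p \<noteq> 0"
      using eq f_nonzero by auto
    have "order 0 h = 1"
    proof -
      have "h = monom 1 1 * reflect_poly f" by (simp add: monom_Suc)
      then show ?thesis using f_nonzero by (simp add: order_mult order_0I)
    qed
    then have "2 * order 0 p = 2 * order 0 q + 1"
      using arg_cong [OF eq, of "order 0"] p q f_nonzero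
      by (simp add: power2_eq_square order_mult del: mult_pCons_right)
    then show False by presburger
  qed
  with eq show ?thesis by simp
qed

text \<open>Rationalise the denominator r + s w by its conjugate r - s w. The norm r^2 - s^2 h is a
  polynomial in z alone, with value r(0)^2 at 0.\<close>

lemma local_ring_elem_cases:
  assumes "\<phi> \<in> local_ring_at_infinity emb z w"
  obtains p q n where "poly n 0 \<noteq> 0" "\<phi> * ev n z = ev p z + ev q z * w"
proof -
  obtain P Q where \<phi>: "\<phi> = eval2 emb P z w / eval2 emb Q z w" and Q: "poly (poly Q 0) 0 \<noteq> 0"
    using assms by (auto simp: local_ring_at_infinity_def)
  obtain p q where pq: "eval2 emb P z w = ev p z + ev q z * w"
    using eval2_reduce [OF w_squared] by blast
  obtain r s where rs: "eval2 emb Q z w = ev r z + ev s z * w" and r0: "poly r 0 \<noteq> 0"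
    using eval2_reduce [OF w_squared, of Q] Q by auto
  let ?n = "r ^ 2 - s ^ 2 * h"
  have n: "ev ?n z = (ev r z + ev s z * w) * (ev r z - ev s z * w)"
    by (simp only: ev_simps(4,6,7) w_squared [symmetric]) (simp add: power2_eq_square algebra_simps)
  have n0: "poly ?n 0 \<noteq> 0"
    using r0 by simp
  \<comment> \<open>The denominator is nonzero in \<open>'k\<close>, so the division defining the
    germ is a genuine one.\<close>
  have "ev r z + ev s z * w \<noteq> 0"
    using w_independent [of r s] r0 by auto
  then have "\<phi> * ev ?n z = (ev p z + ev q z * w) * (ev r z - ev s z * w)"
    by (simp only: \<phi> n pq rs) simp
  also have "\<dots> = ev (p * r - q * s * h) z + ev (q * r - p * s) z * w"
    by (simp only: ev_simps(4,6,7) w_squared [symmetric]) (simp add: power2_eq_square algebra_simps)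
  finally show ?thesis
    using that n0 by blast
qed

text \<open>The quotient of w^(2l) by z^l is the l-th power of \<open>reflect_poly f\<close> at z, a
  unit of the local ring because its value at infinity is nonzero.\<close>

lemma w_power_mult_in_local_ring_iff:
  "w ^ (2 * l) * \<phi> \<in> local_ring_at_infinity emb z w
    \<longleftrightarrow> z ^ l * \<phi> \<in> local_ring_at_infinity emb z w"
proof -
  define u where "u = ev (reflect_poly f ^ l) z"
  have u: "u \<noteq> 0"
    using ev_z_nonzero [of "reflect_poly f ^ l"] f_nonzero by (simp add: u_def)
  have w: "w ^ (2 * l) = u * z ^ l"
    by (simp add: u_def power_mult w_squared power_mult_distrib)
  have u_in: "u \<in> local_ring_at_infinity emb z w" "1 / u \<in> local_ring_at_infinity emb z w"
    using ev_in_local_ring [of "reflect_poly f ^ l"]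
      ev_divide_in_local_ring [of "reflect_poly f ^ l" 1] f_nonzero
    by (simp_all add: u_def)
  show ?thesis
  proof
    assume "w ^ (2 * l) * \<phi> \<in> local_ring_at_infinity emb z w"
    from local_ring_mult [OF u_in(2) this] show "z ^ l * \<phi> \<in> local_ring_at_infinity emb z w"
      using u unfolding w by simp
  next
    assume "z ^ l * \<phi> \<in> local_ring_at_infinity emb z w"
    from local_ring_mult [OF u_in(1) this]
    show "w ^ (2 * l) * \<phi> \<in> local_ring_at_infinity emb z w"
      unfolding w mult.assoc .
  qed
qed

section \<open>The stalk and the global sections of the divisor\<close>

lemma divisor_stalk_at_infinity_eq:
  "divisor_stalk_at_infinity emb z w (2 * l) = (\<lambda>\<phi>. \<phi> * x ^ l) ` local_ring_at_infinity emb z w"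
proof -
  have "\<phi> \<in> (\<lambda>\<phi>. \<phi> * x ^ l) ` R \<longleftrightarrow> z ^ l * \<phi> \<in> R" for \<phi> R
    using x_nonzero by (auto simp: z_def image_iff field_simps intro!: bexI [of _ "\<phi> / x ^ l"])
  then show ?thesis
    by (auto simp: divisor_stalk_at_infinity_def w_power_mult_in_local_ring_iff)
qed

lemma regular_imp_degree_le:
  assumes l: "l \<le> g"
    and "z ^ l * (ev a x + ev b x * y) \<in> local_ring_at_infinity emb z w"
  shows "degree a \<le> l \<and> b = 0"
proof -
  obtain p q n where n: "poly n 0 \<noteq> 0"
    and eq: "z ^ l * (ev a x + ev b x * y) * ev n z = ev p z + ev q z * w"
    using assms(2) local_ring_elem_cases by blast
  \<comment> \<open>A bound for \<open>degree a\<close>, \<open>degree b + g + 1\<close> and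
    \<open>l\<close>: multiplying by z^m clears all poles, and no subtraction from \<open>m\<close>
    is truncated.\<close>
  define m where "m = degree a + degree b + g + 1 + l"
  define A where "A = monom 1 (m - degree a) * reflect_poly a"
  define B where "B = monom 1 (m - (degree b + g + 1)) * reflect_poly b"
  have cancel: "z ^ (m - k) = z ^ m * x ^ k" if "k \<le> m" for k
    using that x_nonzero z_nonzero by (simp add: power_diff z_def field_simps)
  have le_m: "degree a \<le> m" "degree b + g + 1 \<le> m"
    by (simp_all add: m_def)
  have A: "ev A z = z ^ m * ev a x"
    by (simp add: A_def ev_x_eq cancel [OF le_m(1)])
  have B: "ev B z * w = z ^ m * (ev b x * y)"
    using x_nonzero cancel [OF le_m(2)]
    by (simp add: B_def ev_x_eq w_def power_add field_simps)
  have "z ^ m = z ^ (m - l) * z ^ l"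
    by (simp add: m_def add_ac flip: power_add)
  then have "(ev A z + ev B z * w) * ev n z =
      z ^ (m - l) * (z ^ l * (ev a x + ev b x * y) * ev n z)"
    unfolding A B by (simp add: algebra_simps)
  also have "\<dots> = z ^ (m - l) * (ev p z + ev q z * w)"
    by (simp only: eq)
  finally have "ev (A * n - monom 1 (m - l) * p) z + ev (B * n - monom 1 (m - l) * q) z * w = 0"
    by (simp add: algebra_simps)
  from w_independent [OF this]
  have "A * n = monom 1 (m - l) * p" "B * n = monom 1 (m - l) * q"
    by simp_all
  \<comment> \<open>As n(0) is nonzero, the power of z must divide \<open>A\<close> and
    \<open>B\<close> themselves.\<close>
  then have dvd: "monom 1 (m - l) dvd A" "monom 1 (m - l) dvd B"
    using n by (metis dvd_triv_left monom_dvd_mult_cancel)+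
  have "m - l \<le> m - degree a" if "a \<noteq> 0"
    using dvd(1) that unfolding A_def by (rule monom_dvd_monom_mult_reflect_poly)
  then have "degree a \<le> l"
    by (cases "a = 0") (auto simp: m_def)
  moreover have "b = 0"
  proof (rule ccontr)
    assume "b \<noteq> 0"
    with dvd(2) have "m - l \<le> m - (degree b + g + 1)"
      unfolding B_def by (rule monom_dvd_monom_mult_reflect_poly)
    with l show False by (simp add: m_def)
  qed
  ultimately show ?thesis ..
qed

text \<open>At infinity x and y have poles of orders 2 and 2g + 1. Even and odd pole orders cannot
  cancel, and 2l < 2g + 1 excludes y.\<close>

lemma divisor_global_sections_eq:
  assumes "l \<le> g"
  shows "divisor_global_sections emb x y z w (2 * l) = {ev a x | a. degree a \<le> l}"
proof (intro equalityI subsetI)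
  fix \<phi> assume "\<phi> \<in> divisor_global_sections emb x y z w (2 * l)"
  then obtain P where P: "\<phi> = eval2 emb P x y" and "z ^ l * \<phi> \<in> local_ring_at_infinity emb z w"
    by (auto simp: divisor_global_sections_def affine_coordinate_ring_def
        divisor_stalk_at_infinity_def w_power_mult_in_local_ring_iff)
  moreover obtain a b where ab: "eval2 emb P x y = ev a x + ev b x * y"
    using eval2_reduce [OF curve_equation] by blast
  ultimately have "degree a \<le> l \<and> b = 0"
    using regular_imp_degree_le [OF assms] by simp
  with P ab show "\<phi> \<in> {ev a x | a. degree a \<le> l}" by auto
next
  fix \<phi> assume "\<phi> \<in> {ev a x | a. degree a \<le> l}"
  then obtain a where \<phi>: "\<phi> = ev a x" and a: "degree a \<le> l" by blast
  have "\<phi> = eval2 emb [:a:] x y" by (simp add: \<phi>)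
  moreover have "z ^ l * \<phi> = ev (monom 1 (l - degree a) * reflect_poly a) z"
    using a x_nonzero z_nonzero by (simp add: \<phi> ev_x_eq power_diff z_def field_simps)
  then have "z ^ l * \<phi> \<in> local_ring_at_infinity emb z w"
    by (simp only: ev_in_local_ring)
  ultimately show "\<phi> \<in> divisor_global_sections emb x y z w (2 * l)"
    unfolding divisor_global_sections_def affine_coordinate_ring_def
      divisor_stalk_at_infinity_def w_power_mult_in_local_ring_iff by blast
qed

section \<open>The basis of powers of x\<close>

lemma sum_powers_eq_ev:
  "(\<Sum>i\<le>l. emb (c i) * x ^ i) = ev (\<Sum>i\<le>l. monom (c i) i) x"
proof -
  interpret e: comm_ring_hom "\<lambda>p. ev p x" by (rule comm_ring_hom_ev)
  show ?thesis by (simp add: e.hom_sum)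
qed

lemma is_basis_family_powers:
  assumes "l \<le> g"
  shows "is_basis_family emb l (\<lambda>j. x ^ j) (divisor_global_sections emb x y z w (2 * l))"
proof -
  interpret V: vector_space "\<lambda>c v. emb c * v"
    by unfold_locales (simp_all add: algebra_simps hom_distribs)
  have coeff: "coeff (\<Sum>i\<le>l. monom (c i) i) j = (if j \<le> l then c j else 0)" for c :: "nat \<Rightarrow> 'a" and j
    by (simp add: coeff_sum)
  \<comment> \<open>Distinct exponents give distinct powers, so sums over the set of powers can be
    reindexed by exponents and read as polynomials in x.\<close>
  have inj: "inj_on (\<lambda>j. x ^ j) S" for S
  proof (rule inj_onI)
    fix i j assume "x ^ i = x ^ j"
    then have "ev (monom 1 i - monom 1 j) x = 0" by simp
    then have "monom 1 i = (monom 1 j :: 'a poly)"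
      using transcendental_x by (metis right_minus_eq)
    then show "i = j" by (metis degree_monom_eq zero_neq_one)
  qed
  have "\<not> V.dependent ((\<lambda>j. x ^ j) ` {..l})"
  proof
    assume "V.dependent ((\<lambda>j. x ^ j) ` {..l})"
    then obtain u j where j: "j \<le> l" "u (x ^ j) \<noteq> 0"
      and sum: "(\<Sum>v\<in>(\<lambda>j. x ^ j) ` {..l}. emb (u v) * v) = 0"
      by (auto simp: V.dependent_finite)
    have "ev (\<Sum>i\<le>l. monom (u (x ^ i)) i) x = 0"
      using sum unfolding sum_powers_eq_ev [symmetric] by (simp add: sum.reindex [OF inj])
    then have "(\<Sum>i\<le>l. monom (u (x ^ i)) i) = 0"
      using transcendental_x by blast
    then show False
      using coeff [of "\<lambda>i. u (x ^ i)" j] j by simp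
  qed
  moreover have "V.span ((\<lambda>j. x ^ j) ` {..l}) = {ev a x | a. degree a \<le> l}"
  proof (intro equalityI subsetI)
    fix v assume "v \<in> V.span ((\<lambda>j. x ^ j) ` {..l})"
    then obtain u where "v = (\<Sum>v\<in>(\<lambda>j. x ^ j) ` {..l}. emb (u v) * v)"
      by (auto simp: V.span_finite)
    then have "v = ev (\<Sum>i\<le>l. monom (u (x ^ i)) i) x"
      unfolding sum_powers_eq_ev [symmetric] by (simp add: sum.reindex [OF inj])
    moreover have "degree (\<Sum>i\<le>l. monom (u (x ^ i)) i) \<le> l"
      by (rule degree_le) (simp add: coeff)
    ultimately show "v \<in> {ev a x | a. degree a \<le> l}" by blast
  next
    fix v assume "v \<in> {ev a x | a. degree a \<le> l}"
    then obtain a where "v = ev a x" "degree a \<le> l" by blast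
    then show "v \<in> V.span ((\<lambda>j. x ^ j) ` {..l})"
      by (auto simp: ev_eq_sum intro!: V.span_sum V.span_scale [OF V.span_base])
  qed
  ultimately show ?thesis
    by (simp add: is_basis_family_def inj divisor_global_sections_eq [OF assms])
qed

section \<open>The Wronskian at infinity\<close>

lemma hasse_wronskian_at_infinity:
  assumes "hasse_derivatives emb (local_ring_at_infinity emb z w) w D"
  shows "hasse_wronskian D l (\<lambda>j. z ^ (l - j))
    = (- 1) ^ ((l + 1) choose 2) * D 1 z ^ ((l + 1) choose 2)"
proof (rule hasse_wronskian_powers)
  \<comment> \<open>The values on the constant 1 come from the rule for powers of \<open>w\<close>
    at exponent 0.\<close>
  have "D k (w ^ 0) = of_nat (0 choose k) * w ^ (0 - k)" for k
    using assms unfolding hasse_derivatives_def by blast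
  then show "D k 1 = (if k = 0 then 1 else 0)" for k
    by (cases k) auto
  have z: "z \<in> local_ring_at_infinity emb z w"
    using power_in_local_ring [of z 1] by simp
  then show "D 0 z = z"
    using assms unfolding hasse_derivatives_def by blast
  show "D k (z * z ^ n) = (\<Sum>i\<le>k. D i z * D (k - i) (z ^ n))" for k n
    using assms z power_in_local_ring [of z n w] unfolding hasse_derivatives_def by blast
qed

end

theorem theorem3p8:
  fixes emb :: "'a::field \<Rightarrow> 'k::field"
    and f :: "'a poly" and g l :: nat
    and x y z w :: 'k
  assumes "hyperelliptic_curve emb f g x y"
    and "1 \<le> l" and "l \<le> g" and "l mod 4 = 1"
    and "z = inverse x" and "w = y / x ^ (g + 1)"
  shows "is_basis_family emb l (\<lambda>j. x ^ j) (divisor_global_sections emb x y z w (2 * l))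
    \<and> divisor_stalk_at_infinity emb z w (2 * l) = (\<lambda>\<phi>. \<phi> * x ^ l) ` local_ring_at_infinity emb z w
    \<and> (\<forall>j\<le>l. x ^ j / x ^ l = z ^ (l - j))
    \<and> (\<forall>D. hasse_derivatives emb (local_ring_at_infinity emb z w) w D \<longrightarrow>
          hasse_wronskian D l (\<lambda>j. z ^ (l - j)) = - (D 1 z ^ ((l + 1) choose 2)))"
proof -
  interpret hyperelliptic_curve emb f g x y by (rule assms(1))
  have zw: "local.z = z" "local.w = w"
    by (simp_all add: z_def w_def assms)
  have "x ^ j / x ^ l = z ^ (l - j)" if "j \<le> l" for j
    using that x_nonzero by (simp add: assms power_diff field_simps)
  moreover have "hasse_wronskian D l (\<lambda>j. z ^ (l - j)) = - (D 1 z ^ ((l + 1) choose 2))"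
    if "hasse_derivatives emb (local_ring_at_infinity emb z w) w D" for D
    using hasse_wronskian_at_infinity [of D l, unfolded zw, OF that] odd_choose_two_of_mod_4 [OF assms(4)]
    by simp
  ultimately show ?thesis
    using is_basis_family_powers [OF assms(3)] divisor_stalk_at_infinity_eq [of l]
    unfolding zw by blast
qed

end
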